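(* Let $(K,|\cdot|)$ be a non-Archimedean nontrivially valued field that is a transcendental extension of its prime field $K_0$, and let $D$ be its ring of integers. Let $n\ge2$, $\hat x=(\hat x_1,\dots,\hat x_n)\in K^n$, $x=(x_1,\dots,x_n)\in K^n$, $(x_1,x_2)\ne(\hat x_1,\hat x_2)$, $0<r<\|(x_1,x_2)-(\hat x_1,\hat x_2)\|$ and $\varepsilon\in(0,1]$. Then there exists a free subgroup $F'\le\mathrm{SA}(n,D,\varepsilon)$ of rank two acting without nontrivial fixed points on $K^n\setminus(\{(\hat x_1,\hat x_2)\}\times K^{n-2})$, on the balls $B[x,r]$ and $B(x,r)$, and on the sphere $S[x,r]$. Moreover, $F'$ can be chosen so that $F'\le\mathrm{SL}(n,D,\varepsilon)$ if $(\hat x_1,\hat x_2)=(0,0)$.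
   Context: A non-Archimedean valuation on a field $K$ is a function $|\cdot|:K\to[0,\infty)$ with $|x|=0\iff x=0$, $|xy|=|x||y|$, $|x+y|\le\max\{|x|,|y|\}$; it is nontrivial if some nonzero element has value different from $1$. $D=\{x\in K:|x|\le1\}$ is the ring of integers. $K^n$ (and $K^2$) carries the norm $\|x\|=\max_i|x_i|$; $B[x,r]=\{y:\|y-x\|\le r\}$, $B(x,r)=\{y:\|y-x\|<r\}$, $S[x,r]=\{y:\|y-x\|=r\}$ in $K^n$. For $\varepsilon\in(0,1]$, $\mathrm{SL}(n,D,\varepsilon)$ is the group of matrices $[a_{ij}]\in\mathrm{SL}(n,D)$ with $|a_{ii}-1|<\varepsilon$ for all $i$ and $|a_{ij}|<\varepsilon$ for $i\ne j$. $\mathrm{SA}(n,D,\varepsilon)$ is the group of affine maps $K^n\to K^n$, $x\mapsto L(x)+\tau$, with $L\in\mathrm{SL}(n,D,\varepsilon)$ and $\tau\in D^n$. Linear maps are affine maps with $\tau=0$. A group acts on a set without nontrivial fixed points if the set is invariant under the group and every point of it has trivial stabilizer. *)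

theory Defs
  imports
    Jordan_Normal_Form.Determinant
    "HOL-Algebra.Algebraic_Closure_Type"
    "HOL-Algebra.Finite_Extensions"
    "HOL-Algebra.Group_Action"
begin

definition nonarch_valuation :: "('a :: field \<Rightarrow> real) \<Rightarrow> bool" where
  "nonarch_valuation v \<longleftrightarrow>
     (\<forall>x. v x \<ge> 0) \<and> (\<forall>x. v x = 0 \<longleftrightarrow> x = 0) \<and>
     (\<forall>x y. v (x * y) = v x * v y) \<and> (\<forall>x y. v (x + y) \<le> max (v x) (v y))"

definition nontrivial_valuation :: "('a :: field \<Rightarrow> real) \<Rightarrow> bool" where
  "nontrivial_valuation v \<longleftrightarrow> (\<exists>x. x \<noteq> 0 \<and> v x \<noteq> 1)"

definition ring_of_integers :: "('a :: field \<Rightarrow> real) \<Rightarrow> 'a set" where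
  "ring_of_integers v = {x. v x \<le> 1}"

definition prime_subfield :: "'a :: field set" where
  "prime_subfield = \<Inter> {F. subfield F (ring_of_type_algebra :: 'a ring)}"

definition transcendental_over_prime_field :: "'a :: field itself \<Rightarrow> bool" where
  "transcendental_over_prime_field _ \<longleftrightarrow>
     (\<exists>t :: 'a. ring.transcendental ring_of_type_algebra prime_subfield t)"

text \<open>The space $K^n$ is \<^term>\<open>carrier_vec n\<close>, so the coordinates $x_1, x_2, \ldots$ are
  \<open>x $ 0\<close>, \<open>x $ 1\<close>, and so on, and $(x_1, x_2)$ is \<^term>\<open>vec_first x 2\<close>.
  The norm is meaningful only in positive dimension.\<close>

definition vnorm :: "('a :: field \<Rightarrow> real) \<Rightarrow> 'a vec \<Rightarrow> real" where
  "vnorm v x = Max ((\<lambda>i. v (x $ i)) ` {..<dim_vec x})"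

definition closed_ball :: "('a :: field \<Rightarrow> real) \<Rightarrow> nat \<Rightarrow> 'a vec \<Rightarrow> real \<Rightarrow> 'a vec set" where
  "closed_ball v n x r = {y \<in> carrier_vec n. vnorm v (y - x) \<le> r}"

definition open_ball :: "('a :: field \<Rightarrow> real) \<Rightarrow> nat \<Rightarrow> 'a vec \<Rightarrow> real \<Rightarrow> 'a vec set" where
  "open_ball v n x r = {y \<in> carrier_vec n. vnorm v (y - x) < r}"

definition vsphere :: "('a :: field \<Rightarrow> real) \<Rightarrow> nat \<Rightarrow> 'a vec \<Rightarrow> real \<Rightarrow> 'a vec set" where
  "vsphere v n x r = {y \<in> carrier_vec n. vnorm v (y - x) = r}"

definition SL_mat :: "('a :: field \<Rightarrow> real) \<Rightarrow> nat \<Rightarrow> real \<Rightarrow> 'a mat set" where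
  "SL_mat v n \<epsilon> = {A \<in> carrier_mat n n.
     det A = 1 \<and>
     (\<forall>i<n. \<forall>j<n. A $$ (i, j) \<in> ring_of_integers v) \<and>
     (\<forall>i<n. v (A $$ (i, i) - 1) < \<epsilon>) \<and>
     (\<forall>i<n. \<forall>j<n. i \<noteq> j \<longrightarrow> v (A $$ (i, j)) < \<epsilon>)}"

text \<open>Maps of $K^n$ are taken extensional on \<^term>\<open>carrier_vec n\<close>, so that the bijective ones
  are exactly the elements of the group \<^term>\<open>BijGroup (carrier_vec n)\<close>.\<close>

definition affine_map :: "nat \<Rightarrow> 'a :: field mat \<Rightarrow> 'a vec \<Rightarrow> 'a vec \<Rightarrow> 'a vec" where
  "affine_map n A \<tau> = (\<lambda>x \<in> carrier_vec n. A *\<^sub>v x + \<tau>)"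

definition SA_maps :: "('a :: field \<Rightarrow> real) \<Rightarrow> nat \<Rightarrow> real \<Rightarrow> ('a vec \<Rightarrow> 'a vec) set" where
  "SA_maps v n \<epsilon> = {affine_map n A \<tau> | A \<tau>.
     A \<in> SL_mat v n \<epsilon> \<and> \<tau> \<in> carrier_vec n \<and> (\<forall>i<n. \<tau> $ i \<in> ring_of_integers v)}"

definition SL_maps :: "('a :: field \<Rightarrow> real) \<Rightarrow> nat \<Rightarrow> real \<Rightarrow> ('a vec \<Rightarrow> 'a vec) set" where
  "SL_maps v n \<epsilon> = {affine_map n A (0\<^sub>v n) | A. A \<in> SL_mat v n \<epsilon>}"

text \<open>A word is a list of letters; the letter \<open>(s, True)\<close> stands for \<open>s\<close> and \<open>(s, False)\<close>
  for its inverse. A group is free on \<open>S\<close> if every element is the value of exactly one reduced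
  word over \<open>S\<close>.\<close>

definition reduced_word :: "('g \<times> bool) list \<Rightarrow> bool" where
  "reduced_word w \<longleftrightarrow> successively (\<lambda>a b. \<not> (fst a = fst b \<and> snd a \<noteq> snd b)) w"

definition word_value :: "('g, 'm) monoid_scheme \<Rightarrow> ('g \<times> bool) list \<Rightarrow> 'g" where
  "word_value G w =
     foldr (\<lambda>(s, e) g. (if e then s else inv\<^bsub>G\<^esub> s) \<otimes>\<^bsub>G\<^esub> g) w \<one>\<^bsub>G\<^esub>"

definition free_on :: "('g, 'm) monoid_scheme \<Rightarrow> 'g set \<Rightarrow> bool" where
  "free_on G S \<longleftrightarrow> group G \<and> S \<subseteq> carrier G \<and>
     bij_betw (word_value G) {w \<in> lists (S \<times> UNIV). reduced_word w} (carrier G)"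

definition free_of_rank :: "('g, 'm) monoid_scheme \<Rightarrow> nat \<Rightarrow> bool" where
  "free_of_rank G k \<longleftrightarrow> (\<exists>S. finite S \<and> card S = k \<and> free_on G S)"

definition acts_without_nontrivial_fixed_points ::
  "('x \<Rightarrow> 'x, 'm) monoid_scheme \<Rightarrow> 'x set \<Rightarrow> bool" where
  "acts_without_nontrivial_fixed_points G E \<longleftrightarrow>
     (\<forall>g \<in> carrier G. g ` E \<subseteq> E) \<and> (\<forall>p \<in> E. stabilizer G (\<lambda>g. g) p = {\<one>\<^bsub>G\<^esub>})"

end

theory Submission
  imports Defs
begin

text \<open>Let \<open>t\<close> be transcendental with \<open>v t\<close> small, and let \<open>g\<^sub>k\<close> be the product of the upper and the
  lower elementary \<open>2 \<times> 2\<close> matrix with off-diagonal entry \<open>t ^ k\<close>. The group generated by \<open>g\<^sub>1\<close> and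
  \<open>g\<^sub>2\<close> acts on the first two coordinates around the center \<open>(xh $ 0, xh $ 1)\<close>; its elements are
  so close to the identity that balls avoiding the center are preserved. It remains to see that
  \<open>1\<close> is not an eigenvalue of a nontrivial reduced word \<open>w\<close>. Replacing \<open>t\<close> by an indeterminate, the
  matrices play ping-pong on pairs of polynomials: \<open>g\<^sub>k\<close> maps into the pairs \<open>(x, y)\<close> with
  \<open>degree x - degree y = k\<close>, its inverse into those with \<open>degree y - degree x = k\<close>, and degrees grow.
  Hence \<open>det (w - 1)\<close> is a nonzero polynomial with coefficients in the image of the integers,
  in every characteristic, and so it does not vanish at the transcendental \<open>t\<close>.\<close>

unbundle no fps_syntax

section \<open>Two by two matrices\<close>

text \<open>Quadruples turn every matrix identity into a ring identity and make sense over any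
  commutative ring, so one word can be evaluated over polynomials and over the field.\<close>

type_synonym 'r mat2 = "'r \<times> 'r \<times> 'r \<times> 'r"

fun mult2 :: "'r::comm_ring_1 mat2 \<Rightarrow> 'r mat2 \<Rightarrow> 'r mat2" where
  "mult2 (a, b, c, d) (a', b', c', d') =
     (a * a' + b * c', a * b' + b * d', c * a' + d * c', c * b' + d * d')"

definition one2 :: "'r::comm_ring_1 mat2" where
  "one2 = (1, 0, 0, 1)"

fun det2 :: "'r::comm_ring_1 mat2 \<Rightarrow> 'r" where
  "det2 (a, b, c, d) = a * d - b * c"

text \<open>The determinant of \<open>M - 1\<close>, that is, the characteristic polynomial of
  \<open>M\<close> at 1; not \<open>det2 M - 1\<close>.\<close>

fun det2_minus_one :: "'r::comm_ring_1 mat2 \<Rightarrow> 'r" where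
  "det2_minus_one (a, b, c, d) = (a - 1) * (d - 1) - b * c"

fun adj2 :: "'r::comm_ring_1 mat2 \<Rightarrow> 'r mat2" where
  "adj2 (a, b, c, d) = (d, - b, - c, a)"

fun act2 :: "'r::comm_ring_1 mat2 \<Rightarrow> 'r \<times> 'r \<Rightarrow> 'r \<times> 'r" where
  "act2 (a, b, c, d) (x, y) = (a * x + b * y, c * x + d * y)"

fun map2x2 :: "('r \<Rightarrow> 's) \<Rightarrow> 'r mat2 \<Rightarrow> 's mat2" where
  "map2x2 f (a, b, c, d) = (f a, f b, f c, f d)"

lemma mult2_assoc: "mult2 (mult2 L M) N = mult2 L (mult2 M N)"
  by (cases L; cases M; cases N) (simp add: algebra_simps)

lemma mult2_one [simp]: "mult2 M one2 = M" "mult2 one2 M = M"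
  by (cases M; simp add: one2_def)+

lemma det2_mult2: "det2 (mult2 M N) = det2 M * det2 N"
  by (cases M; cases N) (simp add: algebra_simps)

lemma det2_one [simp]: "det2 one2 = 1"
  by (simp add: one2_def)

lemma det2_adj2 [simp]: "det2 (adj2 M) = det2 M"
  by (cases M) (simp add: algebra_simps)

lemma adj2_adj2 [simp]: "adj2 (adj2 M) = M"
  by (cases M) simp

lemma mult2_adj2: "det2 M = 1 \<Longrightarrow> mult2 M (adj2 M) = one2" "det2 M = 1 \<Longrightarrow> mult2 (adj2 M) M = one2"
  by (cases M; simp add: one2_def algebra_simps)+

lemma act2_mult2: "act2 (mult2 M N) p = act2 M (act2 N p)"
  by (cases M; cases N; cases p) (simp add: algebra_simps)

lemma act2_one [simp]: "act2 one2 p = p"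
  by (cases p) (simp add: one2_def)

lemma act2_zero [simp]: "act2 M (0, 0) = (0, 0)"
  by (cases M) simp

text \<open>If its determinant vanishes, \<open>M - 1\<close> kills the columns of its adjugate,
  which up to sign are \<open>(b, 1 - a)\<close> and \<open>(1 - d, c)\<close>. No division occurs,
  so the fixed vector stays over the domain. If both columns are zero, \<open>M\<close> is the
  identity.\<close>

lemma fixed_vector_if_det2_minus_one_zero:
  assumes "det2_minus_one M = (0::'r::idom)"
  shows "\<exists>p. p \<noteq> (0, 0) \<and> act2 M p = p"
proof -
  obtain a b c d where M: "M = (a, b, c, d)"
    by (cases M)
  have det: "(a - 1) * (d - 1) = b * c"
    using assms by (simp add: M)
  consider "(b, 1 - a) \<noteq> (0, 0)" | "(1 - d, c) \<noteq> (0, 0)" | "M = one2"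
    by (auto simp: M one2_def)
  then show ?thesis
  proof cases
    case 1
    have "act2 M (b, 1 - a) = (b, 1 - a)"
      using det by (simp add: M algebra_simps)
    with 1 show ?thesis by blast
  next
    case 2
    have "act2 M (1 - d, c) = (1 - d, c)"
      using det by (simp add: M algebra_simps)
    with 2 show ?thesis by blast
  next
    case 3
    have "act2 M (1, 0) = (1, 0)" by (simp add: 3)
    then show ?thesis by (intro exI[of _ "(1, 0)"]) simp
  qed
qed

text \<open>Cramer's rule: applying the adjugate of \<open>M - 1\<close> to
  \<open>(M - 1) p = 0\<close> gives the determinant times \<open>p\<close>, and a nonzero entry of
  \<open>p\<close> cancels.\<close>

lemma det2_minus_one_zero_if_fixed_vector:
  assumes "p \<noteq> (0, 0)" "act2 M p = p"
  shows "det2_minus_one M = (0::'r::idom)"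
proof -
  obtain a b c d x y where M: "M = (a, b, c, d)" and p: "p = (x, y)"
    by (cases M; cases p)
  have 1: "(a - 1) * x + b * y = 0" and 2: "c * x + (d - 1) * y = 0"
    using assms(2) by (auto simp: M p algebra_simps)
  have "det2_minus_one M * x = (d - 1) * ((a - 1) * x + b * y) - b * (c * x + (d - 1) * y)"
    by (simp add: M algebra_simps)
  moreover have "det2_minus_one M * y = (a - 1) * (c * x + (d - 1) * y) - c * ((a - 1) * x + b * y)"
    by (simp add: M algebra_simps)
  ultimately show ?thesis
    using assms(1) unfolding 1 2 by (auto simp: p)
qed


section \<open>Words\<close>

abbreviation inv_letter :: "'g \<times> bool \<Rightarrow> 'g \<times> bool" where
  "inv_letter a \<equiv> (fst a, \<not> snd a)"

definition inv_word :: "('g \<times> bool) list \<Rightarrow> ('g \<times> bool) list" where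
  "inv_word w = rev (map inv_letter w)"

lemma inv_word_simps [simp]:
  "inv_word [] = []" "inv_word (a # w) = inv_word w @ [inv_letter a]"
  "inv_word (u @ w) = inv_word w @ inv_word u" "inv_word w = [] \<longleftrightarrow> w = []"
  by (simp_all add: inv_word_def)

lemma inv_word_inv_word [simp]: "inv_word (inv_word w) = w"
  by (induction w) auto

lemma set_inv_word: "set (inv_word w) = inv_letter ` set w"
  by (simp add: inv_word_def)

lemma last_inv_word: "w \<noteq> [] \<Longrightarrow> last (inv_word w) = inv_letter (hd w)"
  by (simp add: inv_word_def last_rev hd_map)

lemma inv_letter_neq_iff: "b \<noteq> inv_letter a \<longleftrightarrow> \<not> (fst a = fst b \<and> snd a \<noteq> snd b)"
  by (cases a; cases b) auto

lemma reduced_word_Nil [simp]: "reduced_word []"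
  by (simp add: reduced_word_def)

lemma reduced_word_Cons:
  "reduced_word (a # w) \<longleftrightarrow> reduced_word w \<and> (w = [] \<or> hd w \<noteq> inv_letter a)"
  by (cases w) (auto simp: reduced_word_def inv_letter_neq_iff)

lemma reduced_word_append:
  "reduced_word (u @ w) \<longleftrightarrow>
     reduced_word u \<and> reduced_word w \<and> (u = [] \<or> w = [] \<or> hd w \<noteq> inv_letter (last u))"
  by (auto simp: reduced_word_def successively_append_iff inv_letter_neq_iff)

text \<open>Reversing and flipping creates no new cancelling neighbours; as \<open>inv_word\<close>
  is an involution, one direction suffices.\<close>

lemma reduced_word_inv_word [simp]: "reduced_word (inv_word w) \<longleftrightarrow> reduced_word w"
proof -
  have "reduced_word (inv_word w)" if "reduced_word w" for w :: "('g \<times> bool) list"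
    using that
  proof (induction w)
    case (Cons a w)
    then have w: "reduced_word (inv_word w)" "w = [] \<or> hd w \<noteq> inv_letter a"
      by (simp_all add: reduced_word_Cons)
    have "reduced_word [inv_letter a]"
      by (simp add: reduced_word_Cons)
    moreover have "hd [inv_letter a] \<noteq> inv_letter (last (inv_word w))" if "w \<noteq> []"
      unfolding last_inv_word[OF that] using w(2) that by (simp only: list.sel) (metis inv_letter_neq_iff)
    ultimately show ?case
      using w(1) inv_word_simps(4)[of w] unfolding inv_word_simps(2) reduced_word_append by blast
  qed simp
  from this[of w] this[of "inv_word w"] show ?thesis by auto
qed

text \<open>The letter \<open>(k, True)\<close> stands for the product of the upper and the lower elementary
  matrix with off-diagonal entry \<open>z ^ k\<close>.\<close>

fun letter2 :: "'r::comm_ring_1 \<Rightarrow> nat \<times> bool \<Rightarrow> 'r mat2" where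
  "letter2 z (k, e) =
     (let h = z ^ k; M = (1 + h * h, h, h, 1) in if e then M else adj2 M)"

fun word2 :: "'r::comm_ring_1 \<Rightarrow> (nat \<times> bool) list \<Rightarrow> 'r mat2" where
  "word2 z [] = one2"
| "word2 z (a # w) = mult2 (letter2 z a) (word2 z w)"

lemma word2_append: "word2 z (u @ w) = mult2 (word2 z u) (word2 z w)"
  by (induction u) (simp_all add: mult2_assoc)

lemma det2_letter2 [simp]: "det2 (letter2 z a) = 1"
  by (cases a) (auto simp: Let_def algebra_simps)

lemma letter2_inv_letter: "letter2 z (inv_letter a) = adj2 (letter2 z a)"
  by (cases a) (simp add: Let_def)

lemma det2_word2 [simp]: "det2 (word2 z w) = 1"
  by (induction w) (simp_all add: det2_mult2)

lemma word2_inv_word: "mult2 (word2 z (inv_word w)) (word2 z w) = one2"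
proof (induction w)
  case (Cons a w)
  have "mult2 (word2 z (inv_word (a # w))) (word2 z (a # w)) =
     mult2 (word2 z (inv_word w))
       (mult2 (mult2 (adj2 (letter2 z a)) (letter2 z a)) (word2 z w))"
    by (simp only: inv_word_simps word2_append word2.simps letter2_inv_letter mult2_one mult2_assoc)
  then show ?case
    using Cons by (simp add: mult2_adj2)
qed simp


section \<open>Ping-pong on pairs of polynomials\<close>

text \<open>The ping-pong tables. The zero polynomial has degree 0, so the component of smaller
  degree is required to be nonzero; for \<open>k \<ge> 1\<close> the other one is then nonzero as
  well.\<close>

fun region :: "nat \<times> bool \<Rightarrow> 'a::idom poly \<times> 'a poly \<Rightarrow> bool" where
  "region (k, e) (x, y) \<longleftrightarrow>
     (if e then y \<noteq> 0 \<and> Polynomial.degree x = Polynomial.degree y + k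
      else x \<noteq> 0 \<and> Polynomial.degree y = Polynomial.degree x + k)"

fun max_degree :: "'a::idom poly \<times> 'a poly \<Rightarrow> nat" where
  "max_degree (x, y) = max (Polynomial.degree x) (Polynomial.degree y)"

text \<open>The signed difference of degrees, \<open>k\<close> or \<open>- k\<close>, recovers the
  letter once exponents are positive.\<close>

lemma region_disjoint:
  assumes "region a p" "region b p" "fst a \<ge> 1" "fst b \<ge> 1"
  shows "a = b"
proof -
  obtain k e l e' x y where eqs: "a = (k, e)" "b = (l, e')" "p = (x, y)"
    by (cases a; cases b; cases p)
  note regions = assms(1,2)[unfolded eqs region.simps]
  show ?thesis
  proof (cases "e = e'")
    case True
    then show ?thesis
      using regions by (auto simp: eqs split: if_splits)
  next
    case False
    have incompatible: "\<not> (m = n + k \<and> n = m + l)" for m n :: nat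
      using assms(3,4) by (simp add: eqs)
    show ?thesis
      using regions False incompatible by (metis (full_types))
  qed
qed

text \<open>A letter is a composition of two shears, \<open>(x, y)\<close> to \<open>(x, z)\<close>
  to \<open>(x + h * z, z)\<close>. The third assumption excludes the only case in which leading
  terms of \<open>h * x\<close> and \<open>y\<close> could cancel, so \<open>z\<close> has the
  larger of their degrees and the second shear adds \<open>k\<close> to it.\<close>

lemma shear_degree:
  fixes h x y :: "'a::idom poly"
  assumes "Polynomial.degree h = k" "k \<ge> 1"
    and "\<not> (x \<noteq> 0 \<and> Polynomial.degree y = Polynomial.degree x + k)" "(x, y) \<noteq> (0, 0)"
  defines "z \<equiv> h * x + y"
  shows "z \<noteq> 0" "Polynomial.degree (x + h * z) = Polynomial.degree z + k"
    "max (Polynomial.degree x) (Polynomial.degree y) < Polynomial.degree (x + h * z)"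
proof -
  have h: "h \<noteq> 0" using assms(1,2) by auto
  have *: "z \<noteq> 0 \<and> Polynomial.degree (x + h * z) = Polynomial.degree z + k \<and>
    max (Polynomial.degree x) (Polynomial.degree y) < Polynomial.degree (x + h * z)"
  \<comment> \<open>For \<open>x = 0\<close> the product \<open>h * x\<close> has degree 0 instead
    of \<open>k + degree x\<close>.\<close>
  proof (cases "x = 0")
    case True
    then show ?thesis
      using assms h by (simp add: degree_mult_eq)
  next
    case False
    have hx: "Polynomial.degree (h * x) = k + Polynomial.degree x"
      using False h assms(1) by (simp add: degree_mult_eq)
    have z: "Polynomial.degree z = max (k + Polynomial.degree x) (Polynomial.degree y)"
    proof (cases "Polynomial.degree y < k + Polynomial.degree x")
      case True
      then show ?thesis
        using degree_add_eq_left[of y "h * x"] by (simp add: z_def hx)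
    next
      case False
      then have "k + Polynomial.degree x < Polynomial.degree y"
        using \<open>x \<noteq> 0\<close> assms(3) by auto
      then show ?thesis
        using degree_add_eq_right[of "h * x" y] by (simp add: z_def hx)
    qed
    then have z0: "z \<noteq> 0" using assms(2) by auto
    then have hz: "Polynomial.degree (h * z) = k + Polynomial.degree z"
      using h assms(1) by (simp add: degree_mult_eq)
    then have "Polynomial.degree (x + h * z) = k + Polynomial.degree z"
      using degree_add_eq_right[of x "h * z"] assms(2) z by simp
    then show ?thesis
      using z z0 assms(2) by auto
  qed
  then show "z \<noteq> 0" "Polynomial.degree (x + h * z) = Polynomial.degree z + k"
    "max (Polynomial.degree x) (Polynomial.degree y) < Polynomial.degree (x + h * z)"
    by auto
qed

abbreviation polyX :: "'a::idom poly" where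
  "polyX \<equiv> [:0, 1:]"

text \<open>The region of the inverse letter is exactly the exceptional set of
  \<open>shear_degree\<close>.\<close>

lemma letter2_ping_pong:
  assumes "fst a \<ge> 1" "p \<noteq> (0, 0)" "\<not> region (inv_letter a) p"
  shows "region a (act2 (letter2 polyX a) p) \<and> max_degree p < max_degree (act2 (letter2 polyX a) p)"
proof -
  obtain k e x y where a: "a = (k, e)" and p: "p = (x, y)"
    by (cases a; cases p)
  define h :: "'a poly" where "h = polyX ^ k"
  have h: "Polynomial.degree h = k" "Polynomial.degree (- h) = k"
    by (simp_all add: h_def degree_power_eq)
  show ?thesis
  proof (cases e)
    case True
    have "act2 (letter2 polyX a) p = (x + h * (h * x + y), h * x + y)"
      by (simp add: a p True h_def[symmetric] algebra_simps)
    then show ?thesis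
      using shear_degree[OF h(1), of x y] assms by (auto simp: a p True less_max_iff_disj)
  next
    \<comment> \<open>The inverse matrix performs the same two shears with the coordinates exchanged
      and \<open>h\<close> replaced by \<open>- h\<close>.\<close>
    case False
    have "act2 (letter2 polyX a) p = (- h * y + x, y + - h * (- h * y + x))"
      by (simp add: a p False h_def[symmetric] algebra_simps)
    then show ?thesis
      using shear_degree[OF h(2), of y x] assms by (auto simp: a p False less_max_iff_disj)
  qed
qed

lemma region_nonzero: "region a p \<Longrightarrow> p \<noteq> (0, 0)"
  by (cases a) (auto split: if_splits)

text \<open>Letters act from the right end of the word. After each one the vector lies in the region
  of the letter just applied, which reducedness separates from the region forbidden for the next; so
  only the initial vector needs an assumption.\<close>

lemma word2_ping_pong:
  assumes "reduced_word w" "w \<noteq> []" "\<forall>a\<in>set w. fst a \<ge> 1"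
    and "p \<noteq> (0, 0)" "\<not> region (inv_letter (last w)) p"
  shows "region (hd w) (act2 (word2 polyX w) p) \<and> max_degree p < max_degree (act2 (word2 polyX w) p)"
  using assms
proof (induction w)
  case (Cons a w)
  show ?case
  proof (cases "w = []")
    case True
    then show ?thesis
      using letter2_ping_pong[of a p] Cons.prems by simp
  next
    case False
    let ?q = "act2 (word2 polyX w) p"
    have IH: "region (hd w) ?q" "max_degree p < max_degree ?q"
      using Cons False by (auto simp: reduced_word_Cons)
    have "\<not> region (inv_letter a) ?q"
      using region_disjoint[OF IH(1), of "inv_letter a"] False Cons.prems
      by (auto simp: reduced_word_Cons)
    then show ?thesis
      using letter2_ping_pong[of a ?q] IH region_nonzero[OF IH(1)] Cons.prems
      by (simp add: act2_mult2)
  qed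
qed simp

text \<open>A cyclically reduced word enlarges the degree of every vector outside one region,
  and its inverse does so outside a second region disjoint from the first.
  All other reduced words are conjugate to shorter ones.\<close>

lemma word2_no_fixed_vector:
  fixes p :: "'a::idom poly \<times> 'a poly"
  assumes "reduced_word w" "w \<noteq> []" "\<forall>a\<in>set w. fst a \<ge> 1" "p \<noteq> (0, 0)"
  shows "act2 (word2 polyX w) p \<noteq> p"
  using assms
proof (induction "length w" arbitrary: w p rule: less_induct)
  case less
  show ?case
  proof (cases "last w = inv_letter (hd w)")
    case False
    show ?thesis
    proof
      \<comment> \<open>As degrees may not grow, \<open>p\<close> lies in the region excluded for
        \<open>w\<close>, hence outside the one excluded for the inverse word. That word then
        enlarges the degree of \<open>p\<close>, although it fixes \<open>p\<close> too.\<close>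
      assume fix_p: "act2 (word2 polyX w) p = p"
      then have "region (inv_letter (last w)) p"
        using word2_ping_pong[OF less.prems] by force
      then have "\<not> region (hd w) p"
        using False region_disjoint[of "hd w" p "inv_letter (last w)"] less.prems by (auto simp: prod_eq_iff)
      then have "\<not> region (inv_letter (last (inv_word w))) p"
        using less.prems by (simp add: last_inv_word)
      then have "max_degree p < max_degree (act2 (word2 polyX (inv_word w)) p)"
        using word2_ping_pong[of "inv_word w" p] less.prems by (auto simp: set_inv_word)
      moreover have "act2 (word2 polyX (inv_word w)) p = p"
        using fix_p by (metis act2_mult2 act2_one word2_inv_word)
      ultimately show False by simp
    qed
  next
    case True
    obtain a u where w: "w = a # u"
      using less.prems by (cases w) auto
    have "u \<noteq> []"
      using True by (auto simp: w prod_eq_iff)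
    then obtain u' where u: "u = u' @ [inv_letter a]"
      using True by (metis append_butlast_last_id last_ConsR list.sel(1) w)
    \<comment> \<open>An empty \<open>u'\<close> would leave \<open>a\<close> next to its inverse in
      the reduced word \<open>w\<close>.\<close>
    have "u' \<noteq> []" "reduced_word u'"
      using less.prems by (auto simp: w u reduced_word_Cons reduced_word_append)
    \<comment> \<open>Conjugation by \<open>?g\<close> would turn a fixed vector \<open>p\<close> of
      \<open>w\<close> into a fixed vector \<open>?q\<close> of the shorter word
      \<open>u'\<close>.\<close>
    let ?g = "letter2 (polyX :: 'a poly) a" and ?q = "act2 (adj2 (letter2 polyX a)) p"
    have g: "act2 (adj2 ?g) (act2 ?g q) = q" "act2 ?g (act2 (adj2 ?g) q) = q" for q
      by (simp_all add: act2_mult2[symmetric] mult2_adj2)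
    have "?q \<noteq> (0, 0)"
      using g(2)[of p] less.prems(4) by auto
    then have neq: "act2 (word2 polyX u') ?q \<noteq> ?q"
      using less.hyps[of u' ?q] less.prems \<open>u' \<noteq> []\<close> \<open>reduced_word u'\<close> by (auto simp: w u)
    have "word2 polyX w = mult2 ?g (mult2 (word2 polyX u') (adj2 ?g))"
      by (simp only: w u word2.simps word2_append letter2_inv_letter mult2_one)
    then have "act2 (word2 polyX w) p = act2 ?g (act2 (word2 polyX u') ?q)"
      by (simp add: act2_mult2)
    moreover have "act2 (adj2 ?g) (act2 ?g (act2 (word2 polyX u') ?q)) = act2 (word2 polyX u') ?q"
      by (rule g(1))
    ultimately show ?thesis
      using neq by auto
  qed
qed

corollary det2_minus_one_word2_polyX:
  assumes "reduced_word w" "w \<noteq> []" "\<forall>a\<in>set w. fst a \<ge> 1"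
  shows "det2_minus_one (word2 (polyX :: 'a::idom poly) w) \<noteq> 0"
  using fixed_vector_if_det2_minus_one_zero word2_no_fixed_vector[OF assms] by blast


section \<open>Specialisation at a transcendental element\<close>

text \<open>Since \<open>\<int>\<close> is the image of the integers in the field, this covers every characteristic.\<close>

definition transcendental_over_Ints :: "'a::field \<Rightarrow> bool" where
  "transcendental_over_Ints t \<longleftrightarrow> (\<forall>p. (\<forall>i. Polynomial.coeff p i \<in> \<int>) \<longrightarrow> poly p t = 0 \<longrightarrow> p = 0)"

text \<open>Evaluation at \<open>t\<close> is a ring homomorphism, and the entries of a word are
  ring expressions in \<open>z\<close>.\<close>

lemma poly_word2: "word2 (poly z t) w = map2x2 (\<lambda>p. poly p t) (word2 z w)"
proof (induction w)
  case (Cons a w)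
  show ?case
    by (cases a; cases "word2 z w") (simp add: Cons Let_def)
qed (simp add: one2_def)

fun int_coeffs2 :: "'a::field poly mat2 \<Rightarrow> bool" where
  "int_coeffs2 (a, b, c, d) \<longleftrightarrow> (\<forall>p\<in>{a, b, c, d}. \<forall>i. Polynomial.coeff p i \<in> \<int>)"

lemma Ints_coeff_mult:
  assumes "\<forall>i. Polynomial.coeff p i \<in> \<int>" "\<forall>i. Polynomial.coeff q i \<in> \<int>"
  shows "Polynomial.coeff (p * q) i \<in> \<int>"
  using assms by (auto simp: coeff_mult intro!: Ints_sum Ints_mult)

lemma Ints_coeff_one: "Polynomial.coeff 1 i \<in> \<int>"
  by (simp add: coeff_1)

lemma Ints_coeff_polyX_power: "Polynomial.coeff (polyX ^ k :: 'a::field poly) i \<in> \<int>"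
proof -
  have "(polyX ^ k :: 'a poly) = Polynomial.monom 1 k"
    by (metis Polynomial.monom_altdef smult_1_left)
  then show ?thesis by simp
qed

lemma int_coeffs2_mult2: "int_coeffs2 M \<Longrightarrow> int_coeffs2 N \<Longrightarrow> int_coeffs2 (mult2 M N)"
  by (cases M; cases N) (auto intro!: Ints_add Ints_coeff_mult)

lemma int_coeffs2_letter2: "int_coeffs2 (letter2 polyX a)"
  by (cases a)
    (auto simp: Let_def intro!: Ints_add Ints_coeff_mult Ints_coeff_one Ints_coeff_polyX_power)

lemma int_coeffs2_word2: "int_coeffs2 (word2 polyX w)"
proof (induction w)
  case Nil
  then show ?case by (simp add: one2_def Ints_coeff_one)
next
  case (Cons a w)
  then show ?case by (simp add: int_coeffs2_mult2 int_coeffs2_letter2)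
qed

lemma det2_minus_one_word2:
  assumes "transcendental_over_Ints t"
    and "reduced_word w" "w \<noteq> []" "\<forall>a\<in>set w. fst a \<ge> 1"
  shows "det2_minus_one (word2 t w) \<noteq> 0"
proof -
  obtain a b c d :: "'a poly" where M: "word2 polyX w = (a, b, c, d)"
    by (cases "word2 (polyX :: 'a poly) w")
  have t: "word2 t w = (poly a t, poly b t, poly c t, poly d t)"
    using poly_word2[of polyX t w] by (simp add: M)
  have "\<forall>i. Polynomial.coeff ((a - 1) * (d - 1) - b * c) i \<in> \<int>"
    using int_coeffs2_word2[where 'a = 'a, of w] Ints_coeff_one[where 'a = 'a]
    by (auto simp: M simp del: coeff_1 intro!: Ints_diff Ints_coeff_mult)
  moreover have "(a - 1) * (d - 1) - b * c \<noteq> 0"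
    using det2_minus_one_word2_polyX[OF assms(2-4), where 'a = 'a] by (simp add: M)
  ultimately have "poly ((a - 1) * (d - 1) - b * c) t \<noteq> 0"
    using assms(1) unfolding transcendental_over_Ints_def by blast
  then show ?thesis by (simp add: t)
qed

section \<open>Small transcendental elements\<close>

lemma carrier_ring_of_type_algebra [simp]: "carrier (ring_of_type_algebra :: 'a::field ring) = UNIV"
  and mult_ring_of_type_algebra [simp]: "x \<otimes>\<^bsub>ring_of_type_algebra\<^esub> y = x * y"
  and add_ring_of_type_algebra [simp]: "x \<oplus>\<^bsub>ring_of_type_algebra\<^esub> y = x + y"
  and one_ring_of_type_algebra [simp]: "\<one>\<^bsub>ring_of_type_algebra\<^esub> = 1"
  and zero_ring_of_type_algebra [simp]: "\<zero>\<^bsub>ring_of_type_algebra\<^esub> = 0"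
  by (simp_all add: ring_of_type_algebra_def)

lemma pow_ring_of_type_algebra [simp]:
  "(x::'a::field) [^]\<^bsub>ring_of_type_algebra\<^esub> (k::nat) = x ^ k"
  by (induction k) (simp_all add: nat_pow_def mult.commute)

lemma a_inv_ring_of_type_algebra [simp]: "\<ominus>\<^bsub>ring_of_type_algebra\<^esub> x = - (x::'a::field)"
proof -
  interpret R: Ring.field "ring_of_type_algebra :: 'a ring"
    by (rule field_from_type_algebra)
  show ?thesis
    using R.minus_equality[of "- x" x] by simp
qed

lemma m_inv_ring_of_type_algebra:
  assumes "x \<noteq> 0"
  shows "inv\<^bsub>ring_of_type_algebra\<^esub> x = inverse (x::'a::field)"
proof -
  interpret R: Ring.field "ring_of_type_algebra :: 'a ring"
    by (rule field_from_type_algebra)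
  show ?thesis
    using R.comm_inv_char[of x "inverse x"] assms by simp
qed

text \<open>HOL-Algebra lists coefficients from the leading one down, \<open>Poly\<close> from the
  constant one up; hence the reversal.\<close>

lemma eval_ring_of_type_algebra:
  "ring.eval ring_of_type_algebra l (t::'a::field) = poly (Poly (rev l)) t"
proof -
  interpret R: Ring.field "ring_of_type_algebra :: 'a ring"
    by (rule field_from_type_algebra)
  show ?thesis
    by (induction l) (simp_all add: Poly_append poly_monom)
qed

lemma subfield_prime_subfield: "subfield (prime_subfield :: 'a::field set) ring_of_type_algebra"
proof -
  interpret R: Ring.field "ring_of_type_algebra :: 'a ring"
    by (rule field_from_type_algebra)
  show ?thesis
    unfolding prime_subfield_def
  proof (rule R.subfieldI'[OF R.subring_Inter])
    show "{F. subfield F (ring_of_type_algebra :: 'a ring)} \<noteq> {}"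
      using R.carrier_is_subfield by blast
  next
    fix z assume "z \<in> \<Inter> {F. subfield F (ring_of_type_algebra :: 'a ring)} - {\<zero>\<^bsub>ring_of_type_algebra\<^esub>}"
    then show "inv\<^bsub>ring_of_type_algebra\<^esub> z \<in> \<Inter> {F. subfield F (ring_of_type_algebra :: 'a ring)}"
      using R.subfield_m_inv(1) by blast
  qed (auto intro: subfieldE)
qed

lemma Ints_subset_prime_subfield: "\<int> \<subseteq> (prime_subfield :: 'a::field set)"
proof
  interpret R: Ring.field "ring_of_type_algebra :: 'a ring"
    by (rule field_from_type_algebra)
  note subring = subfieldE(1)[OF subfield_prime_subfield[where 'a = 'a]]
  note closed = subringE(2,3,5,6,7)[OF subring, simplified]
  have nat: "of_nat k \<in> (prime_subfield :: 'a set)" for k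
    by (induction k) (auto intro: closed)
  fix z :: 'a assume "z \<in> \<int>"
  then show "z \<in> prime_subfield"
    by (cases rule: Ints_cases, metis nat closed(3) of_int_of_nat)
qed

lemma transcendental_over_IntsI:
  assumes "ring.transcendental ring_of_type_algebra prime_subfield (t::'a::field)"
  shows "transcendental_over_Ints t"
  unfolding transcendental_over_Ints_def
proof (intro allI impI)
  interpret R: Ring.field "ring_of_type_algebra :: 'a ring"
    by (rule field_from_type_algebra)
  fix p :: "'a poly"
  assume p: "\<forall>i. Polynomial.coeff p i \<in> \<int>" "poly p t = 0"
  show "p = 0"
  proof (rule ccontr)
    assume "p \<noteq> 0"
    \<comment> \<open>The leading coefficient comes first; a nonzero head is the normal form that
      \<open>univ_poly\<close> demands.\<close>
    let ?l = "rev (coeffs p)"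
    have "set ?l \<subseteq> prime_subfield"
      using p(1) Ints_subset_prime_subfield by (auto simp: coeffs_def)
    moreover have "hd ?l \<noteq> 0"
      using \<open>p \<noteq> 0\<close> by (simp add: hd_rev last_coeffs_eq_coeff_degree)
    ultimately have "?l \<in> carrier (univ_poly ring_of_type_algebra prime_subfield)"
      by (simp add: univ_poly_def polynomial_def)
    moreover have "?l \<noteq> []"
      using \<open>p \<noteq> 0\<close> by simp
    ultimately show False
      using R.algebraicI[of ?l prime_subfield t] assms p(2)
      by (simp add: eval_ring_of_type_algebra over_def)
  qed
qed

section \<open>Elementary properties of non-Archimedean valuations\<close>

lemma nonarch_valuation_zero: "nonarch_valuation v \<Longrightarrow> v 0 = 0"
  by (simp add: nonarch_valuation_def)

lemma nonarch_valuation_one: "nonarch_valuation v \<Longrightarrow> v 1 = 1"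
  unfolding nonarch_valuation_def
  by (metis mult_cancel_right2 mult.right_neutral zero_neq_one)

lemma nonarch_valuation_power: "nonarch_valuation v \<Longrightarrow> v (x ^ k) = v x ^ k"
  by (induction k) (auto simp: nonarch_valuation_one, simp add: nonarch_valuation_def)

lemma nonarch_valuation_inverse: "nonarch_valuation v \<Longrightarrow> v (inverse x) = inverse (v x)"
proof (cases "x = 0")
  case False
  assume v: "nonarch_valuation v"
  have "v x * v (inverse x) = 1"
    using v False by (metis nonarch_valuation_def nonarch_valuation_one right_inverse)
  then show ?thesis
    by (metis inverse_unique)
qed (simp add: nonarch_valuation_zero)

lemma nonarch_valuation_minus: "nonarch_valuation v \<Longrightarrow> v (- x) = v x"
proof -
  assume v: "nonarch_valuation v"
  have "v (- 1) * v (- 1) = 1"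
    using v by (metis minus_mult_minus mult_1 nonarch_valuation_def nonarch_valuation_one)
  moreover have "v (- 1) \<ge> 0"
    using v by (simp add: nonarch_valuation_def)
  ultimately have "v (- 1) = 1"
    using power2_eq_1_iff[of "v (- 1)"] by (auto simp: power2_eq_square)
  then show ?thesis
    using v by (metis mult_1 mult_minus_left nonarch_valuation_def)
qed

text \<open>The elements algebraic over the prime field form a proper subfield, so for \<open>z \<noteq> 0\<close> and
  \<open>s\<close> transcendental it cannot contain both \<open>z ^ j * s\<close> and \<open>z ^ Suc j * s\<close>.\<close>

lemma small_transcendental_exists:
  fixes v :: "'a::field \<Rightarrow> real"
  assumes v: "nonarch_valuation v" and "nontrivial_valuation v"
    and "transcendental_over_prime_field TYPE('a)" and "\<delta> > 0"
  shows "\<exists>t. v t < \<delta> \<and> transcendental_over_Ints t"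
proof -
  interpret R: Ring.field "ring_of_type_algebra :: 'a ring"
    by (rule field_from_type_algebra)
  define T where "T = ring.transcendental ring_of_type_algebra (prime_subfield :: 'a set)"
  obtain s where s: "T s"
    using assms(3) by (auto simp: transcendental_over_prime_field_def T_def)
  have alg: "subfield {z :: 'a. \<not> T z} ring_of_type_algebra"
    using R.subfield_of_algebraics[OF subfield_prime_subfield] by (simp add: T_def over_def)
  note subring = subfieldE(1)[OF alg]
  have alg_mult: "\<not> T (y * z)" if "\<not> T y" "\<not> T z" for y z
    using subringE(6)[OF subring, of y z] that by simp
  have alg_one: "\<not> T 1" and alg_zero: "\<not> T 0"
    using subringE(2,3)[OF subring] by auto
  have alg_inverse: "\<not> T (inverse z)" if "\<not> T z" for z
    using R.subfield_m_inv(1)[OF alg, of z] that alg_zero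
    by (cases "z = 0") (auto simp: m_inv_ring_of_type_algebra)
  have alg_power: "\<not> T (z ^ k)" if "\<not> T z" for z k
    by (induction k) (auto simp: alg_one alg_mult that)
  have "s \<noteq> 0" using s alg_zero by auto
  obtain y where y: "y \<noteq> 0" "v y \<noteq> 1"
    using assms(2) by (auto simp: nontrivial_valuation_def)
  have "v y > 0"
    using v y by (simp add: nonarch_valuation_def order_less_le)
  \<comment> \<open>Inverting an element of value above 1 gives one of value below 1, whose powers
    shrink \<open>s\<close>.\<close>
  define z where "z = (if v y < 1 then y else inverse y)"
  have z: "z \<noteq> 0" "0 < v z" "v z < 1"
    using y \<open>v y > 0\<close> by (auto simp: z_def nonarch_valuation_inverse[OF v] inverse_less_1_iff)
  have vs: "v s > 0"
    using v \<open>s \<noteq> 0\<close> by (simp add: nonarch_valuation_def order_less_le)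
  obtain j where j: "v z ^ j < \<delta> / v s"
    using real_arch_pow_inv[of "\<delta> / v s" "v z"] z vs \<open>\<delta> > 0\<close> by auto
  have vj: "v (z ^ i * s) = v z ^ i * v s" for i
    using v by (simp add: nonarch_valuation_def nonarch_valuation_power[OF v])
  have small: "v (z ^ j * s) < \<delta>" "v (z ^ Suc j * s) < \<delta>"
  proof -
    show "v (z ^ j * s) < \<delta>"
      using j vs unfolding vj by (simp add: pos_less_divide_eq)
    moreover have "v z ^ Suc j * v s \<le> v z ^ j * v s"
      using z vs by (simp add: mult_left_le_one_le)
    ultimately show "v (z ^ Suc j * s) < \<delta>"
      unfolding vj by linarith
  qed
  have "T (z ^ j * s) \<or> T (z ^ Suc j * s)"
  proof (rule ccontr)
    assume "\<not> ?thesis"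
    then have j: "\<not> T (z ^ j * s)" "\<not> T (z ^ Suc j * s)" by auto
    \<comment> \<open>A quotient of two algebraic elements makes \<open>z\<close> algebraic, and
      then \<open>s\<close> as well.\<close>
    have "z = z ^ Suc j * s * inverse (z ^ j * s)"
      using z \<open>s \<noteq> 0\<close> by (simp add: field_simps)
    then have "\<not> T z" using j alg_mult alg_inverse by metis
    moreover have "s = inverse (z ^ j) * (z ^ j * s)"
      using z by (simp add: field_simps)
    ultimately show False
      using s j(1) alg_mult alg_inverse alg_power by metis
  qed
  then show ?thesis
    using small transcendental_over_IntsI unfolding T_def by blast
qed

section \<open>Matrices close to the identity\<close>

text \<open>Congruence to the identity modulo the elements of value at most \<delta>, an ideal of
  the ring of integers if \<open>0 \<le> \<delta>\<close> and
  \<open>\<delta> \<le> 1\<close>.\<close>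

fun near_one :: "('a::field \<Rightarrow> real) \<Rightarrow> real \<Rightarrow> 'a mat2 \<Rightarrow> bool" where
  "near_one v \<delta> (a, b, c, d) \<longleftrightarrow> v (a - 1) \<le> \<delta> \<and> v b \<le> \<delta> \<and> v c \<le> \<delta> \<and> v (d - 1) \<le> \<delta>"

lemma near_one_mult2:
  assumes v: "nonarch_valuation v" and "\<delta> \<le> 1" "near_one v \<delta> M" "near_one v \<delta> N"
  shows "near_one v \<delta> (mult2 M N)"
proof -
  obtain a b c d a' b' c' d' where MN: "M = (a, b, c, d)" "N = (a', b', c', d')"
    by (cases M; cases N)
  have add: "v (x + y) \<le> \<delta>" if "v x \<le> \<delta>" "v y \<le> \<delta>" for x y
    using v that unfolding nonarch_valuation_def by (smt (verit) max.absorb1 max.absorb2 nle_le)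
  have mult: "v (x * y) \<le> \<delta>" if "v x \<le> \<delta>" "v y \<le> \<delta>" for x y
  proof -
    have "v x * v y \<le> \<delta> * 1"
      using v that \<open>\<delta> \<le> 1\<close> by (intro mult_mono) (auto simp: nonarch_valuation_def intro: order_trans)
    then show ?thesis using v by (simp add: nonarch_valuation_def)
  qed
  \<comment> \<open>Entrywise, \<open>M N - 1\<close> is
    \<open>(M - 1) (N - 1) + (M - 1) + (N - 1)\<close>, a sum of terms of value at most
    \<delta>.\<close>
  have eqs: "a * a' + b * c' - 1 = (a - 1) * (a' - 1) + (a - 1) + (a' - 1) + b * c'"
    "a * b' + b * d' = (a - 1) * b' + b' + b * (d' - 1) + b"
    "c * a' + d * c' = c * (a' - 1) + c + (d - 1) * c' + c'"
    "c * b' + d * d' - 1 = c * b' + (d - 1) * (d' - 1) + (d - 1) + (d' - 1)"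
    by (simp_all add: algebra_simps)
  show ?thesis
    using assms(3,4) unfolding MN mult2.simps near_one.simps eqs by (intro conjI add mult) auto
qed

text \<open>By the ultrametric inequality the bound does not deteriorate with the length of the
  word, so one \<open>t\<close> serves the whole group.\<close>

lemma near_one_word2:
  assumes v: "nonarch_valuation v" and "v t \<le> 1" "\<forall>a\<in>set w. fst a \<ge> 1"
  shows "near_one v (v t) (word2 t w)"
  using assms(3)
proof (induction w)
  case Nil
  have "v t \<ge> 0" using v by (simp add: nonarch_valuation_def)
  then show ?case
    by (simp add: one2_def nonarch_valuation_zero[OF v])
next
  case (Cons a w)
  have t0: "v t \<ge> 0" using v by (simp add: nonarch_valuation_def)
  have pow: "v t ^ k \<le> v t" if "k \<ge> 1" for k
    using power_decreasing[of 1 k "v t"] that t0 \<open>v t \<le> 1\<close> by simp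
  have "near_one v (v t) (1 + t ^ k * t ^ k, t ^ k, t ^ k, 1)" if "k \<ge> 1" for k
    using v pow[OF that] pow[of "k + k"] that t0
    by (simp add: nonarch_valuation_power[OF v] nonarch_valuation_zero[OF v] flip: power_add)
  then have "near_one v (v t) (letter2 t a)"
    using Cons.prems by (cases a) (auto simp: Let_def nonarch_valuation_minus[OF v])
  then show ?case
    using Cons by (simp add: near_one_mult2[OF v \<open>v t \<le> 1\<close>])
qed

section \<open>A criterion for freeness\<close>

abbreviation words_over :: "'g set \<Rightarrow> ('g \<times> bool) list set" where
  "words_over S \<equiv> lists (S \<times> UNIV)"

context group
begin

definition letter_value :: "'a \<times> bool \<Rightarrow> 'a" where
  "letter_value a = (if snd a then fst a else inv (fst a))"

lemma word_value_Nil [simp]: "word_value G [] = \<one>"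
  by (simp add: word_value_def)

lemma word_value_Cons [simp]: "word_value G (a # w) = letter_value a \<otimes> word_value G w"
  by (cases a) (simp add: word_value_def letter_value_def)

context
  fixes S assumes S: "S \<subseteq> carrier G"
begin

lemma letter_value_closed: "a \<in> S \<times> UNIV \<Longrightarrow> letter_value a \<in> carrier G"
  using S by (auto simp: letter_value_def)

lemma letter_value_inv_letter: "a \<in> S \<times> UNIV \<Longrightarrow> letter_value (inv_letter a) = inv (letter_value a)"
  using S by (auto simp: letter_value_def)

lemma inv_letter_closed: "a \<in> S \<times> UNIV \<Longrightarrow> inv_letter a \<in> S \<times> UNIV"
  by auto

lemma inv_word_closed: "w \<in> words_over S \<Longrightarrow> inv_word w \<in> words_over S"
  by (induction w rule: lists.induct) auto

lemma word_value_closed: "w \<in> words_over S \<Longrightarrow> word_value G w \<in> carrier G"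
  by (induction w rule: lists.induct) (simp_all add: letter_value_closed)

lemma word_value_append:
  "u \<in> words_over S \<Longrightarrow> w \<in> words_over S \<Longrightarrow>
     word_value G (u @ w) = word_value G u \<otimes> word_value G w"
  by (induction u rule: lists.induct) (simp_all add: letter_value_closed word_value_closed m_assoc)

lemma word_value_inv_word: "w \<in> words_over S \<Longrightarrow> word_value G (inv_word w) = inv (word_value G w)"
proof (induction w rule: lists.induct)
  case (Cons a w)
  have "[inv_letter a] \<in> words_over S"
    using inv_letter_closed[OF Cons(1)] by simp
  then show ?case
    using Cons inv_letter_closed[OF Cons(1)]
    by (simp only: inv_word_simps word_value_append inv_word_closed)
      (simp add: letter_value_inv_letter letter_value_closed word_value_closed inv_mult_group)
qed simp

text \<open>Reduce the tail first; the first letter then either extends the reduced tail or cancels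
  against its head.\<close>

lemma reduced_word_exists:
  assumes "w \<in> words_over S"
  shows "\<exists>u\<in>words_over S. reduced_word u \<and> word_value G u = word_value G w"
  using assms
proof (induction w rule: lists.induct)
  case Nil
  show ?case by (intro bexI[of _ "[]"]) auto
next
  case (Cons a w)
  then obtain u where u: "u \<in> words_over S" "reduced_word u" "word_value G u = word_value G w"
    by blast
  show ?case
  proof (cases "reduced_word (a # u)")
    case True
    then show ?thesis
      using u Cons(1) by (intro bexI[of _ "a # u"]) auto
  next
    case False
    then obtain u' where u': "u = inv_letter a # u'"
      using u(2) by (cases u) (auto simp: reduced_word_Cons)
    have "u' \<in> words_over S" "reduced_word u'"
      using u by (auto simp: u' reduced_word_Cons)
    moreover have "word_value G u' = word_value G (a # w)"
      using Cons(1) \<open>u' \<in> words_over S\<close> u(3) letter_value_inv_letter[OF Cons(1)]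
        letter_value_closed[OF Cons(1)] word_value_closed[of u']
      by (simp add: u' m_assoc[symmetric] flip: u(3))
    ultimately show ?thesis by blast
  qed
qed

text \<open>A common first letter is cancelled. Otherwise the inverse of one word followed by the
  other is a reduced word of value one.\<close>

lemma inj_on_word_value:
  assumes nontriv: "\<And>w. w \<in> words_over S \<Longrightarrow> reduced_word w \<Longrightarrow> word_value G w = \<one> \<Longrightarrow> w = []"
    and prems: "u \<in> words_over S" "reduced_word u" "w \<in> words_over S" "reduced_word w"
      "word_value G u = word_value G w"
  shows "u = w"
  using prems
proof (induction u arbitrary: w rule: list.induct)
  case Nil
  then show ?case using nontriv[of w] by simp
next
  case (Cons a u)
  show ?case
  proof (cases "w = [] \<or> hd w \<noteq> a")
    case True
    \<comment> \<open>The left part ends in the inverse of \<open>a\<close> and \<open>w\<close>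
      does not start with \<open>a\<close>, so nothing cancels at the junction.\<close>
    let ?x = "inv_word (a # u) @ w"
    have "inv_word (a # u) \<in> words_over S"
      by (rule inv_word_closed) (rule Cons.prems(1))
    moreover have "reduced_word (inv_word (a # u))"
      using Cons.prems by (simp only: reduced_word_inv_word)
    moreover have "last (inv_word (a # u)) = inv_letter a"
      by simp
    moreover have "w = [] \<or> hd w \<noteq> inv_letter (inv_letter a)"
      using True by (simp only: fst_conv snd_conv not_not prod.collapse)
    ultimately have "?x \<in> words_over S" "reduced_word ?x"
      using Cons.prems(3,4) by (simp_all only: reduced_word_append append_in_lists_conv simp_thms)
    moreover have "word_value G ?x = \<one>"
      using Cons.prems word_value_closed[of w] \<open>inv_word (a # u) \<in> words_over S\<close>
      by (simp only: word_value_append word_value_inv_word) simp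
    ultimately show ?thesis
      using nontriv[of ?x] by simp
  next
    case False
    then obtain w' where w: "w = a # w'"
      by (cases w) auto
    then have "word_value G u = word_value G w'"
      using Cons.prems by (auto simp: letter_value_closed word_value_closed l_cancel)
    then show ?thesis
      using Cons by (auto simp: w reduced_word_Cons)
  qed
qed

abbreviation reduced_words where
  "reduced_words \<equiv> {w \<in> words_over S. reduced_word w}"

text \<open>By \<open>reduced_word_exists\<close> all words have values in this set, and words are
  closed under concatenation and inversion.\<close>

lemma subgroup_word_values: "subgroup (word_value G ` reduced_words) G"
proof -
  have value_mem: "word_value G w \<in> word_value G ` reduced_words" if "w \<in> words_over S" for w
    using reduced_word_exists[OF that] by (metis (mono_tags, lifting) image_eqI mem_Collect_eq)
  show ?thesis
  proof
    show "word_value G ` reduced_words \<subseteq> carrier G"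
      using word_value_closed by auto
    show "\<one> \<in> word_value G ` reduced_words"
      using value_mem[of "[]"] by simp
  next
    fix x y assume "x \<in> word_value G ` reduced_words" "y \<in> word_value G ` reduced_words"
    then obtain u w where "u \<in> words_over S" "w \<in> words_over S" "x = word_value G u" "y = word_value G w"
      by blast
    then show "x \<otimes> y \<in> word_value G ` reduced_words"
      using value_mem[of "u @ w"] by (simp add: word_value_append)
  next
    fix x assume "x \<in> word_value G ` reduced_words"
    then obtain u where "u \<in> words_over S" "x = word_value G u"
      by blast
    then show "inv x \<in> word_value G ` reduced_words"
      using value_mem[of "inv_word u"] by (simp add: word_value_inv_word inv_word_closed)
  qed
qed

lemma free_on_word_values:
  assumes nontriv: "\<And>w. w \<in> words_over S \<Longrightarrow> reduced_word w \<Longrightarrow> word_value G w = \<one> \<Longrightarrow> w = []"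
  shows "free_on (G\<lparr>carrier := word_value G ` reduced_words\<rparr>) S"
proof -
  define F where "F = word_value G ` reduced_words"
  let ?H = "G\<lparr>carrier := F\<rparr>"
  have subgroup: "subgroup F G"
    unfolding F_def by (rule subgroup_word_values)
  have S_mem: "s \<in> F" if "s \<in> S" for s
    unfolding F_def using that S
    by (intro image_eqI[of _ _ "[(s, True)]"]) (auto simp: letter_value_def reduced_word_Cons)
  \<comment> \<open>Inverses in the subgroup agree with those in the whole group.\<close>
  have "word_value ?H w = word_value G w" if "w \<in> words_over S" for w
    using that
    by (induction w rule: lists.induct)
      (auto simp: word_value_def m_inv_consistent[OF subgroup S_mem])
  moreover have "inj_on (word_value G) reduced_words"
  proof (rule inj_onI)
    fix u w assume "u \<in> reduced_words" "w \<in> reduced_words" "word_value G u = word_value G w"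
    then show "u = w"
      by (intro inj_on_word_value[OF nontriv]) auto
  qed
  ultimately have "bij_betw (word_value ?H) reduced_words (carrier ?H)"
    by (auto simp: bij_betw_def inj_on_def F_def)
  moreover have "group ?H"
    by (rule subgroup.subgroup_is_group[OF subgroup is_group])
  ultimately show ?thesis
    using S S_mem by (simp add: free_on_def F_def subset_iff)
qed

end

end

section \<open>Affine maps moving the first two coordinates\<close>

fun block2 :: "nat \<Rightarrow> 'a::field mat2 \<Rightarrow> 'a mat" where
  "block2 n (a, b, c, d) =
     four_block_mat (mat 2 2 (\<lambda>(i, j). if i = 0 then if j = 0 then a else b else if j = 0 then c else d))
       (0\<^sub>m 2 (n - 2)) (0\<^sub>m (n - 2) 2) (1\<^sub>m (n - 2))"

text \<open>On the first two coordinates this is \<open>q - M q\<close>, so that the affine map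
  becomes \<open>y \<mapsto> q + M (y - q)\<close>, with center
  \<open>(q $ 0, q $ 1)\<close>.\<close>

fun translation2 :: "nat \<Rightarrow> 'a::field vec \<Rightarrow> 'a mat2 \<Rightarrow> 'a vec" where
  "translation2 n q (a, b, c, d) = vec n (\<lambda>i.
     if i = 0 then - ((a - 1) * q $ 0 + b * q $ 1)
     else if i = 1 then - (c * q $ 0 + (d - 1) * q $ 1) else 0)"

definition affine2 :: "nat \<Rightarrow> 'a::field vec \<Rightarrow> 'a mat2 \<Rightarrow> 'a vec \<Rightarrow> 'a vec" where
  "affine2 n q M = affine_map n (block2 n M) (translation2 n q M)"

lemma translation2_carrier [simp]: "translation2 n q M \<in> carrier_vec n"
  by (cases M) simp

lemma block2_carrier: "n \<ge> 2 \<Longrightarrow> block2 n M \<in> carrier_mat n n"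
  by (cases M) auto

lemma block2_index:
  assumes "n \<ge> 2" "i < n" "j < n"
  shows "block2 n (a, b, c, d) $$ (i, j) =
    (if i = 0 then if j = 0 then a else if j = 1 then b else 0
     else if i = 1 then if j = 0 then c else if j = 1 then d else 0
     else if i = j then 1 else 0)"
  using assms by (auto simp: less_2_cases_iff)

lemma det_block2:
  assumes "n \<ge> 2"
  shows "det (block2 n M) = det2 M"
proof -
  obtain a b c d where M: "M = (a, b, c, d)"
    by (cases M)
  define A where "A = mat 2 2 (\<lambda>(i, j). if i = (0::nat) then if j = (0::nat) then a else b
    else if j = 0 then c else d)"
  have A: "A \<in> carrier_mat 2 2"
    by (simp add: A_def)
  have "det A = (\<Sum>j<2. A $$ (0, j) * cofactor A 0 j)"
    by (rule laplace_expansion_row[OF A]) simp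
  also have "\<dots> = a * d - b * c"
    using A by (simp add: numeral_2_eq_2 cofactor_def det_single mat_delete_def A_def)
  finally have "det A = a * d - b * c" .
  moreover have "det (block2 n M) = det A * det (1\<^sub>m (n - 2))"
    unfolding M block2.simps A_def[symmetric]
    by (rule det_four_block_mat_lower_left_zero[OF A]) auto
  ultimately show ?thesis
    by (simp add: M)
qed

lemma affine2_carrier [simp]: "y \<in> carrier_vec n \<Longrightarrow> n \<ge> 2 \<Longrightarrow> affine2 n q M y \<in> carrier_vec n"
  using block2_carrier[of n M] by (auto simp: affine2_def affine_map_def)

text \<open>The displacement \<open>(M - 1) (y - q)\<close> is isolated because fixed points and all
  estimates depend on it.\<close>

lemma affine2_index:
  fixes y q :: "'a::field vec"
  assumes n: "n \<ge> 2" and y: "y \<in> carrier_vec n" and i: "i < n"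
  shows "affine2 n q (a, b, c, d) y $ i =
    (if i = 0 then y $ 0 + ((a - 1) * (y $ 0 - q $ 0) + b * (y $ 1 - q $ 1))
     else if i = 1 then y $ 1 + (c * (y $ 0 - q $ 0) + (d - 1) * (y $ 1 - q $ 1))
     else y $ i)"
proof -
  let ?A = "block2 n (a, b, c, d)"
  have A: "?A \<in> carrier_mat n n"
    by (rule block2_carrier[OF n])
  have split: "(\<Sum>j\<in>{0..<n}. f j) = f 0 + (f 1 + (\<Sum>j\<in>{2..<n}. f j))" for f :: "nat \<Rightarrow> 'a"
    using n by (simp add: sum.atLeast_Suc_lessThan numeral_2_eq_2)
  have "affine2 n q (a, b, c, d) y $ i = (?A *\<^sub>v y) $ i + translation2 n q (a, b, c, d) $ i"
    using y i A by (simp add: affine2_def affine_map_def del: block2.simps)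
  also have "(?A *\<^sub>v y) $ i = (\<Sum>j\<in>{0..<n}. ?A $$ (i, j) * y $ j)"
    using A y i by (simp add: scalar_prod_def del: block2.simps)
  also have "\<dots> = (if i = 0 then a * y $ 0 + b * y $ 1 else if i = 1 then c * y $ 0 + d * y $ 1
      else y $ i)"
  proof (cases "i < 2")
    case True
    have "(\<Sum>j\<in>{2..<n}. ?A $$ (i, j) * y $ j) = 0"
      using True i by (intro sum.neutral) (auto simp: block2_index[OF n] simp del: block2.simps)
    then show ?thesis
      using True n i unfolding split by (auto simp: block2_index[OF n] simp del: block2.simps)
  next
    case False
    have "(\<Sum>j\<in>{0..<n}. ?A $$ (i, j) * y $ j) = (\<Sum>j\<in>{0..<n}. if i = j then y $ j else 0)"
      using False i by (intro sum.cong) (auto simp: block2_index[OF n] simp del: block2.simps)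
    then show ?thesis
      using False i by simp
  qed
  finally show ?thesis
    using i by (simp add: algebra_simps)
qed

text \<open>All these maps are conjugates of linear ones by the same translation, hence multiply
  like their matrices.\<close>

lemma affine2_mult2:
  assumes n: "n \<ge> 2" and y: "y \<in> carrier_vec n"
  shows "affine2 n q M (affine2 n q N y) = affine2 n q (mult2 M N) y"
proof (rule eq_vecI)
  show "dim_vec (affine2 n q M (affine2 n q N y)) = dim_vec (affine2 n q (mult2 M N) y)"
    using n y by (metis affine2_carrier carrier_vecD)
  fix i assume "i < dim_vec (affine2 n q (mult2 M N) y)"
  then have i: "i < n"
    using n y by (metis affine2_carrier carrier_vecD)
  have n': "0 < n" "1 < n" "Suc 0 < n" using n by auto
  obtain a b c d a' b' c' d' where MN: "M = (a, b, c, d)" "N = (a', b', c', d')"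
    by (cases M; cases N)
  show "affine2 n q M (affine2 n q N y) $ i = affine2 n q (mult2 M N) y $ i"
    using i n' by (simp add: MN affine2_index[OF n] y n) (simp add: algebra_simps)
qed

lemma affine2_one2: "n \<ge> 2 \<Longrightarrow> y \<in> carrier_vec n \<Longrightarrow> affine2 n q one2 y = y"
  by (intro eq_vecI) (simp_all add: one2_def affine2_index carrier_vecD[OF affine2_carrier])

lemma affine2_Bij:
  assumes n: "n \<ge> 2" and "det2 M = 1"
  shows "affine2 n q M \<in> Bij (carrier_vec n)"
proof -
  have "bij_betw (affine2 n q M) (carrier_vec n) (carrier_vec n)"
    using assms
    by (intro bij_betwI[where g = "affine2 n q (adj2 M)"])
      (auto simp: affine2_mult2 mult2_adj2 affine2_one2)
  then show ?thesis
    by (simp add: Bij_def affine2_def affine_map_def)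
qed

lemma affine2_compose:
  assumes "n \<ge> 2" "det2 M = 1" "det2 N = 1"
  shows "affine2 n q M \<otimes>\<^bsub>BijGroup (carrier_vec n)\<^esub> affine2 n q N = affine2 n q (mult2 M N)"
proof -
  have "compose (carrier_vec n) (affine2 n q M) (affine2 n q N) = affine2 n q (mult2 M N)"
    using assms(1)
    by (intro extensionalityI[of _ "carrier_vec n"])
      (auto simp: compose_def affine2_mult2, auto simp: affine2_def affine_map_def)
  then show ?thesis
    using assms by (simp add: BijGroup_def affine2_Bij)
qed

lemma affine2_one: "n \<ge> 2 \<Longrightarrow> affine2 n q one2 = \<one>\<^bsub>BijGroup (carrier_vec n)\<^esub>"
  by (intro extensionalityI[of _ "carrier_vec n"])
    (auto simp: BijGroup_def affine2_one2, auto simp: affine2_def affine_map_def)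

text \<open>The first two coordinates of \<open>p - q\<close> form a nonzero vector fixed by
  \<open>M\<close>.\<close>

lemma affine2_fixed_point:
  fixes p q :: "'a::field vec"
  assumes n: "n \<ge> 2" and p: "p \<in> carrier_vec n" and "affine2 n q M p = p"
    and "p $ 0 \<noteq> q $ 0 \<or> p $ 1 \<noteq> q $ 1"
  shows "det2_minus_one M = 0"
proof -
  obtain a b c d where M: "M = (a, b, c, d)"
    by (cases M)
  have "affine2 n q M p $ 0 = p $ 0" "affine2 n q M p $ 1 = p $ 1"
    by (simp_all add: assms(3))
  then have "act2 M (p $ 0 - q $ 0, p $ 1 - q $ 1) = (p $ 0 - q $ 0, p $ 1 - q $ 1)"
    using n affine2_index[OF n p, of 0 q a b c d] affine2_index[OF n p, of 1 q a b c d]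
    by (simp add: M algebra_simps)
  then show ?thesis
    using assms(4) by (intro det2_minus_one_zero_if_fixed_vector) auto
qed

section \<open>Integrality and closeness to the identity for the affine maps\<close>

lemma max_le_multI:
  assumes v: "nonarch_valuation v" and "v a \<le> \<delta>" "v b \<le> \<delta>" "v x \<le> m" "v y \<le> m"
  shows "v (a * x + b * y) \<le> \<delta> * m"
proof -
  have *: "v (a * x) \<le> \<delta> * m" if "v a \<le> \<delta>" "v x \<le> m" for a x
  proof -
    have "v a * v x \<le> \<delta> * m"
      using v that by (intro mult_mono) (auto simp: nonarch_valuation_def intro: order_trans)
    then show ?thesis using v by (simp add: nonarch_valuation_def)
  qed
  have "v (a * x + b * y) \<le> max (v (a * x)) (v (b * y))"
    using v unfolding nonarch_valuation_def by blast
  also have "\<dots> \<le> \<delta> * m"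
    using * assms by simp
  finally show ?thesis .
qed

lemma block2_SL_mat:
  assumes v: "nonarch_valuation v" and n: "n \<ge> 2" and "near_one v \<delta> M" "det2 M = 1"
    and \<delta>: "\<delta> < \<epsilon>" "0 < \<epsilon>" "\<epsilon> \<le> 1"
  shows "block2 n M \<in> SL_mat v n \<epsilon>"
proof -
  obtain a b c d where M: "M = (a, b, c, d)"
    by (cases M)
  have entries: "v (a - 1) \<le> \<delta>" "v b \<le> \<delta>" "v c \<le> \<delta>" "v (d - 1) \<le> \<delta>"
    using assms(3) by (simp_all add: M)
  \<comment> \<open>Diagonal entries are integral as sums of 1 and a small element.\<close>
  have diag: "v z \<le> 1" if "v (z - 1) \<le> \<delta>" for z
  proof -
    have "v (z - 1 + 1) \<le> max (v (z - 1)) (v 1)"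
      using v unfolding nonarch_valuation_def by blast
    then show ?thesis
      using that \<delta> nonarch_valuation_one[OF v] by simp
  qed
  have "v (block2 n M $$ (i, j)) \<le> 1" if "i < n" "j < n" for i j
    using that entries diag \<delta> nonarch_valuation_one[OF v] nonarch_valuation_zero[OF v]
    by (simp add: M block2_index[OF n] del: block2.simps)
  moreover have "v (block2 n M $$ (i, i) - 1) < \<epsilon>" if "i < n" for i
    using that entries \<delta> nonarch_valuation_zero[OF v]
    by (simp add: M block2_index[OF n] del: block2.simps)
  moreover have "v (block2 n M $$ (i, j)) < \<epsilon>" if "i < n" "j < n" "i \<noteq> j" for i j
    using that entries \<delta> nonarch_valuation_zero[OF v]
    by (simp add: M block2_index[OF n] del: block2.simps)
  ultimately show ?thesis
    using n assms(4) by (auto simp: SL_mat_def ring_of_integers_def det_block2 block2_carrier)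
qed

text \<open>The translation is \<open>- (M - 1) q\<close>; the last bound on \<delta> keeps it
  integral even if \<open>q\<close> is not.\<close>

lemma affine2_SA_maps:
  fixes q :: "'a::field vec"
  assumes v: "nonarch_valuation v" and n: "n \<ge> 2" and "near_one v \<delta> M" "det2 M = 1"
    and \<delta>: "\<delta> < \<epsilon>" "0 < \<epsilon>" "\<epsilon> \<le> 1" "\<delta> * max (v (q $ 0)) (v (q $ 1)) \<le> 1"
  shows "affine2 n q M \<in> SA_maps v n \<epsilon>"
proof -
  obtain a b c d where M: "M = (a, b, c, d)"
    by (cases M)
  have "v (- (z * q $ 0 + z' * q $ 1)) \<le> 1" if "v z \<le> \<delta>" "v z' \<le> \<delta>" for z z'
    using max_le_multI[OF v that, of "q $ 0" _ "q $ 1"] \<delta>(4)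
    by (simp only: nonarch_valuation_minus[OF v]) (meson max.cobounded1 max.cobounded2 order_trans)
  then have "\<forall>i<n. translation2 n q M $ i \<in> ring_of_integers v"
    using assms(3) nonarch_valuation_zero[OF v] by (auto simp: M ring_of_integers_def simp del: minus_add_distrib)
  moreover have "block2 n M \<in> SL_mat v n \<epsilon>"
    by (rule block2_SL_mat) fact+
  ultimately show ?thesis
    unfolding SA_maps_def affine2_def using translation2_carrier by blast
qed

lemma affine2_SL_maps:
  fixes q :: "'a::field vec"
  assumes "nonarch_valuation v" "n \<ge> 2" "near_one v \<delta> M" "det2 M = 1"
    and "\<delta> < \<epsilon>" "0 < \<epsilon>" "\<epsilon> \<le> 1" "q $ 0 = 0" "q $ 1 = 0"
  shows "affine2 n q M \<in> SL_maps v n \<epsilon>"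
proof -
  have "translation2 n q M = 0\<^sub>v n"
    using assms(8,9) by (cases M) (auto intro!: eq_vecI)
  then show ?thesis
    using block2_SL_mat[OF assms(1-7)] by (auto simp: SL_maps_def affine2_def)
qed


section \<open>Balls and spheres\<close>

lemma vnorm_le_iff:
  fixes y :: "'a::field vec"
  shows "dim_vec y > 0 \<Longrightarrow> vnorm v y \<le> r \<longleftrightarrow> (\<forall>i<dim_vec y. v (y $ i) \<le> r)"
  unfolding vnorm_def by (subst Max_le_iff) auto

lemma vnorm_less_iff:
  fixes y :: "'a::field vec"
  shows "dim_vec y > 0 \<Longrightarrow> vnorm v y < r \<longleftrightarrow> (\<forall>i<dim_vec y. v (y $ i) < r)"
  unfolding vnorm_def by (subst Max_less_iff) auto

lemma mem_closed_ball_iff: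
  fixes x y :: "'a::field vec"
  shows "n > 0 \<Longrightarrow> x \<in> carrier_vec n \<Longrightarrow>
     y \<in> closed_ball v n x r \<longleftrightarrow> y \<in> carrier_vec n \<and> (\<forall>i<n. v (y $ i - x $ i) \<le> r)"
  by (auto simp: closed_ball_def vnorm_le_iff)

lemma mem_open_ball_iff:
  fixes x y :: "'a::field vec"
  shows "n > 0 \<Longrightarrow> x \<in> carrier_vec n \<Longrightarrow>
     y \<in> open_ball v n x r \<longleftrightarrow> y \<in> carrier_vec n \<and> (\<forall>i<n. v (y $ i - x $ i) < r)"
  by (auto simp: open_ball_def vnorm_less_iff)

lemma vsphere_eq: "vsphere v n x r = closed_ball v n x r - open_ball v n x r"
  by (auto simp: vsphere_def closed_ball_def open_ball_def)

text \<open>As \<open>y - q = (y - x) + (x - q)\<close> has entries of value at most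
  \<open>m\<close> in the first two coordinates, \<open>(M - 1) (y - q)\<close> has entries of value
  at most \<open>\<delta> * m\<close>, below \<open>r\<close>.\<close>

lemma affine2_displacement:
  fixes x y q :: "'a::field vec"
  assumes v: "nonarch_valuation v" and n: "n \<ge> 2" and "near_one v \<delta> M" "r > 0"
    and x: "x \<in> carrier_vec n" and y: "y \<in> closed_ball v n x r" and i: "i < n"
    and m: "v (x $ 0 - q $ 0) \<le> m" "v (x $ 1 - q $ 1) \<le> m" "r \<le> m" "\<delta> * m < r"
  shows "v (affine2 n q M y $ i - y $ i) < r"
proof -
  obtain a b c d where M: "M = (a, b, c, d)"
    by (cases M)
  have y': "y \<in> carrier_vec n" "v (y $ 0 - x $ 0) \<le> r" "v (y $ 1 - x $ 1) \<le> r"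
    using y n x by (auto simp: mem_closed_ball_iff)
  have dist: "v (y $ k - q $ k) \<le> m" if "v (y $ k - x $ k) \<le> r" "v (x $ k - q $ k) \<le> m" for k
  proof -
    have "v ((y $ k - x $ k) + (x $ k - q $ k)) \<le> max (v (y $ k - x $ k)) (v (x $ k - q $ k))"
      using v unfolding nonarch_valuation_def by blast
    then show ?thesis
      using that m by simp
  qed
  have "v (z * (y $ 0 - q $ 0) + z' * (y $ 1 - q $ 1)) < r" if "v z \<le> \<delta>" "v z' \<le> \<delta>" for z z'
    using max_le_multI[OF v that dist[OF y'(2) m(1)] dist[OF y'(3) m(2)]] m(4) by linarith
  then show ?thesis
    using assms(3,4) i nonarch_valuation_zero[OF v]
    by (simp add: M affine2_index[OF n y'(1)])
qed

text \<open>Points move by less than \<open>r\<close>, which by the ultrametric inequality leads out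
  of neither ball.\<close>

lemma affine2_closed_ball:
  fixes x y q :: "'a::field vec"
  assumes v: "nonarch_valuation v" and n: "n \<ge> 2" and "near_one v \<delta> M" "r > 0"
    and x: "x \<in> carrier_vec n" and y: "y \<in> closed_ball v n x r"
    and m: "v (x $ 0 - q $ 0) \<le> m" "v (x $ 1 - q $ 1) \<le> m" "r \<le> m" "\<delta> * m < r"
  shows "affine2 n q M y \<in> closed_ball v n x r"
    and "y \<in> open_ball v n x r \<Longrightarrow> affine2 n q M y \<in> open_ball v n x r"
proof -
  have y': "y \<in> carrier_vec n"
    using y n x by (auto simp: mem_closed_ball_iff)
  let ?z = "affine2 n q M y"
  have z: "v (?z $ i - x $ i) \<le> max (v (?z $ i - y $ i)) (v (y $ i - x $ i))" "v (?z $ i - y $ i) < r"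
    if "i < n" for i
  proof -
    have "v ((?z $ i - y $ i) + (y $ i - x $ i)) \<le> max (v (?z $ i - y $ i)) (v (y $ i - x $ i))"
      using v unfolding nonarch_valuation_def by blast
    then show "v (?z $ i - x $ i) \<le> max (v (?z $ i - y $ i)) (v (y $ i - x $ i))"
      by simp
    show "v (?z $ i - y $ i) < r"
      by (rule affine2_displacement[OF v n assms(3,4) x y that m])
  qed
  show "?z \<in> closed_ball v n x r"
    using z y n x y' by (fastforce simp: mem_closed_ball_iff)
  show "?z \<in> open_ball v n x r" if "y \<in> open_ball v n x r"
    using z that n x y' by (fastforce simp: mem_open_ball_iff)
qed

section \<open>Words in the affine maps, and the fibre over the center\<close>

lemma reduced_word_mapD: "reduced_word (map (map_prod f id) w) \<Longrightarrow> reduced_word w"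
  by (auto simp: reduced_word_def successively_map elim: successively_mono)

text \<open>Transfers the results on matrix words to words in the group of bijections.\<close>

lemma word_value_affine2:
  assumes "n \<ge> 2"
  shows "word_value (BijGroup (carrier_vec n))
      (map (map_prod (\<lambda>k. affine2 n q (letter2 t (k, True))) id) w) = affine2 n q (word2 t w)"
proof (induction w)
  case Nil
  then show ?case
    using assms by (simp add: group.word_value_Nil[OF group_BijGroup] affine2_one)
next
  case (Cons a w)
  interpret group "BijGroup (carrier_vec n :: 'a vec set)"
    by (rule group_BijGroup)
  let ?f = "\<lambda>k. affine2 n q (letter2 t (k, True))"
  have mem: "affine2 n q M \<in> carrier (BijGroup (carrier_vec n))" if "det2 M = 1" for M
    using affine2_Bij[OF assms that] by (simp add: BijGroup_def)
  have "inv\<^bsub>BijGroup (carrier_vec n)\<^esub> (affine2 n q M) = affine2 n q (adj2 M)" if "det2 M = 1" for M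
    using that assms by (intro inv_equality mem) (simp_all add: affine2_compose mult2_adj2 affine2_one)
  then have letter: "letter_value (map_prod ?f id a) = affine2 n q (letter2 t a)"
    using letter2_inv_letter[of t "(fst a, True)"] det2_letter2[of t "(fst a, True)"]
    by (cases a) (auto simp: letter_value_def simp del: letter2.simps)
  then show ?case
    by (simp only: list.map word_value_Cons letter Cons word2.simps
        affine2_compose[OF assms det2_letter2 det2_word2])
qed

lemma vec_first_2_eq_iff:
  fixes p q :: "'a vec"
  shows "vec_first p 2 = vec_first q 2 \<longleftrightarrow> p $ 0 = q $ 0 \<and> p $ 1 = q $ 1"
  by (auto simp: vec_first_def vec_eq_iff less_2_cases_iff)

lemma mem_prefix_iff:
  fixes p q :: "'a vec"
  assumes "n \<ge> 2" "p \<in> carrier_vec n"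
  shows "p \<in> {vec_first q 2 @\<^sub>v w | w. w \<in> carrier_vec (n - 2)} \<longleftrightarrow>
    p $ 0 = q $ 0 \<and> p $ 1 = q $ 1"
proof
  assume "p \<in> {vec_first q 2 @\<^sub>v w | w. w \<in> carrier_vec (n - 2)}"
  then show "p $ 0 = q $ 0 \<and> p $ 1 = q $ 1"
    by (auto simp: vec_first_def)
next
  assume "p $ 0 = q $ 0 \<and> p $ 1 = q $ 1"
  moreover have "vec_first p 2 @\<^sub>v vec_last p (n - 2) = p"
    using assms by (metis le_add_diff_inverse vec_first_last_append)
  ultimately show "p \<in> {vec_first q 2 @\<^sub>v w | w. w \<in> carrier_vec (n - 2)}"
    using vec_first_2_eq_iff[of p q] by (metis (mono_tags, lifting) mem_Collect_eq vec_last_carrier)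
qed

section \<open>Construction of the free group and its actions\<close>

theorem theorem4p19:
  fixes v :: "'a :: field \<Rightarrow> real"
    and n :: nat
    and xh x :: "'a vec"
    and r \<epsilon> :: real
  assumes "nonarch_valuation v"
    and "nontrivial_valuation v"
    and "transcendental_over_prime_field TYPE('a)"
    and "n \<ge> 2"
    and "xh \<in> carrier_vec n"
    and "x \<in> carrier_vec n"
    and "vec_first x 2 \<noteq> vec_first xh 2"
    and "0 < r"
    and "r < vnorm v (vec_first x 2 - vec_first xh 2)"
    and "0 < \<epsilon>"
    and "\<epsilon> \<le> 1"
  shows "\<exists>F. subgroup F (BijGroup (carrier_vec n)) \<and>
    F \<subseteq> SA_maps v n \<epsilon> \<and>
    (vec_first xh 2 = 0\<^sub>v 2 \<longrightarrow> F \<subseteq> SL_maps v n \<epsilon>) \<and>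
    (let G = (BijGroup (carrier_vec n))\<lparr>carrier := F\<rparr> in
      free_of_rank G 2 \<and>
      acts_without_nontrivial_fixed_points G
        (carrier_vec n - {vec_first xh 2 @\<^sub>v w | w. w \<in> carrier_vec (n - 2)}) \<and>
      acts_without_nontrivial_fixed_points G (closed_ball v n x r) \<and>
      acts_without_nontrivial_fixed_points G (open_ball v n x r) \<and>
      acts_without_nontrivial_fixed_points G (vsphere v n x r))"
proof -
  note v = assms(1) and n = assms(4)
  have n': "0 < n" "1 < n" using n by auto
  define m where "m = vnorm v (vec_first x 2 - vec_first xh 2)"
  have m_le: "m \<le> s \<longleftrightarrow> v (x $ 0 - xh $ 0) \<le> s \<and> v (x $ 1 - xh $ 1) \<le> s" for s
    unfolding m_def by (subst vnorm_le_iff) (auto simp: vec_first_def less_2_cases_iff)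
  then have m: "v (x $ 0 - xh $ 0) \<le> m" "v (x $ 1 - xh $ 1) \<le> m" "r < m" "0 < m"
    using assms(8,9) by (auto simp: m_def[symmetric])
  define c where "c = max (v (xh $ 0)) (v (xh $ 1))"
  have "c \<ge> 0"
    using v by (simp add: c_def nonarch_valuation_def le_max_iff_disj)
  \<comment> \<open>The bounds give, in turn, matrices within \<epsilon> of the identity, integral
    translations (with \<open>c + 1\<close> since \<open>c\<close> may be 0), and displacements
    below \<open>r\<close> on the balls.\<close>
  obtain t where t: "v t < min \<epsilon> (min (1 / (c + 1)) (r / m))" "transcendental_over_Ints t"
    using small_transcendental_exists[OF v assms(2,3), of "min \<epsilon> (min (1 / (c + 1)) (r / m))"]
      assms(8,10) m \<open>c \<ge> 0\<close> by auto
  have vt: "v t < \<epsilon>" "v t \<le> 1" "v t * c \<le> 1" "v t * m < r"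
  proof -
    show "v t < \<epsilon>" "v t \<le> 1" "v t * m < r"
      using t(1) assms(11) m by (auto simp: pos_less_divide_eq)
    have "v t * (c + 1) < 1"
      using t(1) \<open>c \<ge> 0\<close> by (auto simp: pos_less_divide_eq)
    moreover have "v t \<ge> 0"
      using v by (simp add: nonarch_valuation_def)
    ultimately show "v t * c \<le> 1"
      by (simp add: distrib_left)
  qed

  interpret G: group "BijGroup (carrier_vec n :: 'a vec set)"
    by (rule group_BijGroup)
  let ?G = "BijGroup (carrier_vec n :: 'a vec set)"
  let ?W = "words_over {1, 2 :: nat}"
  let ?T = "\<lambda>u. affine2 n xh (word2 t u)"
  define f where "f k = affine2 n xh (letter2 t (k, True))" for k
  define S where "S = f ` {1, 2}"

  have W: "\<forall>a\<in>set u. fst a \<ge> 1" if "u \<in> ?W" for u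
    using that by auto
  have W_inv: "inv_word u \<in> ?W" if "u \<in> ?W" for u
    using that by (auto simp: in_lists_conv_set set_inv_word)
  have near: "near_one v (v t) (word2 t u)" if "u \<in> ?W" for u
    using near_one_word2[OF v vt(2) W[OF that]] .
  have inverse: "?T (inv_word u) (?T u p) = p" if "p \<in> carrier_vec n" for u p
    using that n by (simp add: affine2_mult2 word2_inv_word affine2_one2)
  have no_fixed: "u = []"
    if "u \<in> ?W" "reduced_word u" "p \<in> carrier_vec n" "p $ 0 \<noteq> xh $ 0 \<or> p $ 1 \<noteq> xh $ 1" "?T u p = p"
    for u and p :: "'a vec"
    using affine2_fixed_point[OF n that(3,5,4)] det2_minus_one_word2[OF t(2) that(2) _ W[OF that(1)]]
    by blast
  have x_moved: "x $ 0 \<noteq> xh $ 0 \<or> x $ 1 \<noteq> xh $ 1"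
    using assms(7) by (auto simp: vec_first_2_eq_iff)
  \<comment> \<open>The identity fixes \<open>x\<close>, which does not lie over the center.\<close>
  have trivial: "u = []" if "u \<in> ?W" "reduced_word u" "?T u = \<one>\<^bsub>?G\<^esub>" for u
    using no_fixed[OF that(1,2) assms(6) x_moved] that(3) assms(6) by (simp add: BijGroup_def)
  have val: "word_value ?G (map (map_prod f id) u) = ?T u" for u
    using word_value_affine2[OF n, of xh t u] unfolding f_def .

  have S_carrier: "S \<subseteq> carrier ?G"
    using n by (auto simp: S_def f_def BijGroup_def intro!: affine2_Bij simp del: letter2.simps)
  \<comment> \<open>Lifts words in the generators to words in the exponents 1 and 2, to which the
    matrix results apply.\<close>
  have words_S: "\<exists>u\<in>?W. w = map (map_prod f id) u" if "w \<in> words_over S" for w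
  proof -
    have "S \<times> UNIV = map_prod f (id :: bool \<Rightarrow> bool) ` ({1, 2} \<times> UNIV)"
      by (simp add: S_def map_prod_surj_on[OF refl refl])
    then show ?thesis
      using that by (auto simp: lists_image)
  qed
  \<comment> \<open>Otherwise the reduced word \<open>[(1, True), (2, False)]\<close> would be
    trivial.\<close>
  have "f 1 \<noteq> f 2"
  proof
    assume "f 1 = f 2"
    have "word_value ?G (map (map_prod f id) [(1, True), (2, False)]) = f 1 \<otimes>\<^bsub>?G\<^esub> inv\<^bsub>?G\<^esub> f 2"
      using S_carrier by (simp add: G.letter_value_def S_def)
    also have "\<dots> = \<one>\<^bsub>?G\<^esub>"
      using S_carrier \<open>f 1 = f 2\<close> by (simp add: S_def)
    finally have "?T [(1, True), (2, False)] = \<one>\<^bsub>?G\<^esub>"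
      unfolding val .
    then show False
      using trivial[of "[(1, True), (2, False)]"] by (simp add: reduced_word_Cons del: word2.simps)
  qed
  then have "card S = 2" "finite S"
    by (simp_all add: S_def)

  define F where "F = word_value ?G ` {w \<in> words_over S. reduced_word w}"
  let ?H = "?G\<lparr>carrier := F\<rparr>"
  have F: "\<exists>u\<in>?W. reduced_word u \<and> g = ?T u" if "g \<in> F" for g
    using that words_S reduced_word_mapD val unfolding F_def by blast
  have subgroup: "subgroup F ?G"
    unfolding F_def by (rule G.subgroup_word_values[OF S_carrier])
  have "free_on ?H S"
    unfolding F_def
  proof (rule G.free_on_word_values[OF S_carrier])
    fix w assume w: "w \<in> words_over S" "reduced_word w" "word_value ?G w = \<one>\<^bsub>?G\<^esub>"
    then show "w = []"
      using words_S[OF w(1)] trivial reduced_word_mapD val by (metis list.map_disc_iff)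
  qed
  then have free: "free_of_rank ?H 2"
    unfolding free_of_rank_def using \<open>card S = 2\<close> \<open>finite S\<close> by blast

  \<comment> \<open>Stabilizers are trivial by \<open>no_fixed\<close>, so each of the four sets
    only has to be invariant and to avoid the fibre over the center.\<close>
  have acts: "acts_without_nontrivial_fixed_points ?H E"
    if E: "\<And>p :: 'a vec. p \<in> E \<Longrightarrow> p \<in> carrier_vec n \<and> (p $ 0 \<noteq> xh $ 0 \<or> p $ 1 \<noteq> xh $ 1)"
      "\<And>u p. u \<in> ?W \<Longrightarrow> p \<in> E \<Longrightarrow> ?T u p \<in> E" for E :: "'a vec set"
    unfolding acts_without_nontrivial_fixed_points_def
  proof (intro conjI ballI)
    fix g assume "g \<in> carrier ?H"
    then show "g ` E \<subseteq> E"
      using F E(2) by fastforce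
  next
    fix p assume p: "p \<in> E"
    have "g = \<one>\<^bsub>?G\<^esub>" if g: "g \<in> F" "g p = p" for g
    proof -
      obtain u where "u \<in> ?W" "reduced_word u" "g = ?T u"
        using F[OF g(1)] by blast
      moreover from this have "u = []"
        using no_fixed[of u p] E(1)[OF p] g(2) by blast
      ultimately show ?thesis
        using n by (simp add: affine2_one)
    qed
    moreover have "\<one>\<^bsub>?G\<^esub> p = p"
      using E(1)[OF p] by (simp add: BijGroup_def)
    ultimately have "{g \<in> F. g p = p} = {\<one>\<^bsub>?G\<^esub>}"
      using subgroup.one_closed[OF subgroup] by blast
    then show "stabilizer ?H (\<lambda>g. g) p = {\<one>\<^bsub>?H\<^esub>}"
      by (simp add: stabilizer_def)
  qed

  \<comment> \<open>A point of the ball over the center would force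
    \<open>m \<le> r\<close>.\<close>
  have not_in_ball: "p \<in> carrier_vec n \<and> (p $ 0 \<noteq> xh $ 0 \<or> p $ 1 \<noteq> xh $ 1)"
    if "p \<in> closed_ball v n x r" for p :: "'a vec"
  proof -
    have p: "p \<in> carrier_vec n" "v (p $ 0 - x $ 0) \<le> r" "v (p $ 1 - x $ 1) \<le> r"
      using that n' assms(6) by (auto simp: mem_closed_ball_iff)
    have "v (x $ 0 - p $ 0) \<le> r" "v (x $ 1 - p $ 1) \<le> r"
      using p nonarch_valuation_minus[OF v, of "p $ 0 - x $ 0"]
        nonarch_valuation_minus[OF v, of "p $ 1 - x $ 1"] by simp_all
    then show ?thesis
      using p(1) m_le[of r] m(3) by auto
  qed
  have open_subset: "open_ball v n x r \<subseteq> closed_ball v n x r"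
    by (auto simp: open_ball_def closed_ball_def)
  have closed: "?T u p \<in> closed_ball v n x r" if "u \<in> ?W" "p \<in> closed_ball v n x r" for u p
    using affine2_closed_ball(1)[OF v n near[OF that(1)] assms(8,6) that(2) m(1,2) _ vt(4)] m(3) by simp
  have open': "?T u p \<in> open_ball v n x r" if "u \<in> ?W" "p \<in> open_ball v n x r" for u p
    using affine2_closed_ball(2)[OF v n near[OF that(1)] assms(8,6) _ m(1,2) _ vt(4) that(2)]
      m(3) that(2) open_subset by auto

  show ?thesis
  proof (intro exI[of _ F] conjI impI subsetI)
    show "subgroup F ?G" by (rule subgroup)
    fix g assume "g \<in> F"
    then obtain u where u: "u \<in> ?W" "g = ?T u"
      using F by blast
    show "g \<in> SA_maps v n \<epsilon>"
      unfolding u(2) using vt(3) by (intro affine2_SA_maps[OF v n near[OF u(1)] _ vt(1) assms(10,11)])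
        (simp_all add: c_def)
    assume "vec_first xh 2 = 0\<^sub>v 2"
    then have "xh $ 0 = 0" "xh $ 1 = 0"
      by (auto simp: vec_first_def vec_eq_iff)
    then show "g \<in> SL_maps v n \<epsilon>"
      unfolding u(2) by (intro affine2_SL_maps[OF v n near[OF u(1)] _ vt(1) assms(10,11)]) simp_all
  next
    let ?E = "carrier_vec n - {vec_first xh 2 @\<^sub>v w | w. w \<in> carrier_vec (n - 2)}"
    have complement: "acts_without_nontrivial_fixed_points ?H ?E"
    proof (rule acts)
      have E: "p \<in> ?E \<longleftrightarrow> p \<in> carrier_vec n \<and> (p $ 0 \<noteq> xh $ 0 \<or> p $ 1 \<noteq> xh $ 1)" for p :: "'a vec"
        using mem_prefix_iff[OF n, of p xh] by blast
      then show "p \<in> carrier_vec n \<and> (p $ 0 \<noteq> xh $ 0 \<or> p $ 1 \<noteq> xh $ 1)" if "p \<in> ?E" for p :: "'a vec"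
        using that by blast
      \<comment> \<open>The fibre over the center is invariant; applying the inverse word shows that
        its complement is invariant too.\<close>
      have center: "?T u p $ 0 = xh $ 0 \<and> ?T u p $ 1 = xh $ 1"
        if "p \<in> carrier_vec n" "p $ 0 = xh $ 0" "p $ 1 = xh $ 1" for u and p :: "'a vec"
        using that n' by (cases "word2 t u") (simp add: affine2_index[OF n])
      fix u p assume "u \<in> ?W" "p \<in> ?E"
      then show "?T u p \<in> ?E"
        using center[of "?T u p" "inv_word u"] inverse[of p u] n unfolding E by auto
    qed
    have sphere: "acts_without_nontrivial_fixed_points ?H (vsphere v n x r)"
    proof (rule acts)
      fix u p assume u: "u \<in> ?W" and p: "p \<in> vsphere v n x r"
      then have "p \<in> carrier_vec n"
        by (simp add: vsphere_def)
      \<comment> \<open>Were the image in the open ball, the inverse word would bring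
        \<open>p\<close> itself into the open ball.\<close>
      then show "?T u p \<in> vsphere v n x r"
        using closed[OF u, of p] open'[OF W_inv[OF u], of "?T u p"] p inverse[of p u]
        by (auto simp: vsphere_eq)
    qed (use not_in_ball in \<open>auto simp: vsphere_eq\<close>)
    have "acts_without_nontrivial_fixed_points ?H (closed_ball v n x r)"
      by (rule acts[OF not_in_ball closed])
    moreover have "acts_without_nontrivial_fixed_points ?H (open_ball v n x r)"
      using open_subset not_in_ball by (intro acts open') auto
    ultimately show "let G = ?H in
      free_of_rank G 2 \<and>
      acts_without_nontrivial_fixed_points G
        (carrier_vec n - {vec_first xh 2 @\<^sub>v w | w. w \<in> carrier_vec (n - 2)}) \<and>
      acts_without_nontrivial_fixed_points G (closed_ball v n x r) \<and>
      acts_without_nontrivial_fixed_points G (open_ball v n x r) \<and>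
      acts_without_nontrivial_fixed_points G (vsphere v n x r)"
      using free complement sphere unfolding Let_def by blast
  qed
qed

end
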